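(* Let $\psi_\alpha(s_\alpha)$ and $\psi_\beta(s_\beta)$ be two regular curves in Euclidean 3-space $\mathbf{E}^3$, parameterized by arclengths $s_\alpha$ and $s_\beta$, with curvatures $\kappa_\alpha$ and $\kappa_\beta$ and principal normal vectors $\mathbf{N}_\alpha$ and $\mathbf{N}_\beta$. Then $\psi_\alpha$ and $\psi_\beta$ are similar curves with variable transformation if and only if the principal normal vectors are the same for the curves, $$\mathbf{N}_\beta(s_\beta)=\mathbf{N}_\alpha(s_\alpha),$$ under the particular variable transformation of the arclengths given by $$\lambda^\beta_\alpha=\frac{ds_\beta}{ds_\alpha}=\frac{\kappa_\alpha}{\kappa_\beta}.$$
   Context: Curves are in Euclidean 3-space $\mathbf{E}^3$ with the usual metric. Let $\psi_\alpha(s_\alpha)$ and $\psi_\beta(s_\beta)$ be two regular curves parameterized by arclengths $s_\alpha$ and $s_\beta$, with curvatures $\kappa_\alpha,\kappa_\beta$, torsions $\tau_\alpha,\tau_\beta$ and Frenet frames $\{\mathbf{T}_\alpha,\mathbf{N}_\alpha,\mathbf{B}_\alpha\}$ and $\{\mathbf{T}_\beta,\mathbf{N}_\beta,\mathbf{B}_\beta\}$ (unit tangent, principal normal, binormal), satisfying the Frenet equations $\mathbf{T}'=\kappa\mathbf{N}$, $\mathbf{N}'=-\kappa\mathbf{T}+\tau\mathbf{B}$, $\mathbf{B}'=-\tau\mathbf{N}$. They are called similar curves with variable transformation $\lambda^\alpha_\beta$ if there exists a variable transformation $s_\alpha=\int\lambda^\alpha_\beta(s_\beta)\,ds_\beta$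 of the arclengths, with $\lambda^\alpha_\beta$ an arbitrary function of the arclength, such that the tangent vectors are the same, $\mathbf{T}_\beta(s_\beta)=\mathbf{T}_\alpha(s_\alpha)$, for all corresponding values of the parameters under the transformation. Thus $\lambda^\alpha_\beta=\frac{ds_\alpha}{ds_\beta}$, $\lambda^\beta_\alpha=\frac{ds_\beta}{ds_\alpha}$ and $\lambda^\alpha_\beta\lambda^\beta_\alpha=1$. Equality of vectors of the two curves "under" a variable transformation means equality for all values of $s_\alpha,s_\beta$ that correspond under that transformation.
   Formalization: Variable transformations are taken with positive λ, and pairs of general helices with opposite nonzero constant ratios τ/κ are excluded; without these the claim fails (e.g. a circular helix and its mirror image have equal N and κ but are not similar). *)

theory Defs
  imports "HOL-Analysis.Analysis"
begin

definition tangent :: "(real \<Rightarrow> real^3) \<Rightarrow> real \<Rightarrow> real^3" where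
  "tangent \<psi> s = vector_derivative \<psi> (at s)"

definition curvature :: "(real \<Rightarrow> real^3) \<Rightarrow> real \<Rightarrow> real" where
  "curvature \<psi> s = norm (vector_derivative (tangent \<psi>) (at s))"

definition principal_normal :: "(real \<Rightarrow> real^3) \<Rightarrow> real \<Rightarrow> real^3" where
  "principal_normal \<psi> s = vector_derivative (tangent \<psi>) (at s) /\<^sub>R curvature \<psi> s"

definition binormal :: "(real \<Rightarrow> real^3) \<Rightarrow> real \<Rightarrow> real^3" where
  "binormal \<psi> s = cross3 (tangent \<psi> s) (principal_normal \<psi> s)"

text \<open>The sign convention is that of the Frenet equation \<open>B' = - \<tau> N\<close>.\<close>

definition torsion :: "(real \<Rightarrow> real^3) \<Rightarrow> real \<Rightarrow> real" where
  "torsion \<psi> s = - (vector_derivative (binormal \<psi>) (at s) \<bullet> principal_normal \<psi> s)"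

text \<open>
  A regular curve parameterized by arclength on a nonempty open interval \<open>I\<close> (possibly
  unbounded), of class \<open>C\<^sup>3\<close> and with nowhere vanishing curvature, so that the Frenet frame
  and the torsion exist at every point of \<open>I\<close>.
\<close>

definition arclength_frenet_curve :: "(real \<Rightarrow> real^3) \<Rightarrow> real set \<Rightarrow> bool" where
  "arclength_frenet_curve \<psi> I \<longleftrightarrow>
     open I \<and> is_interval I \<and> I \<noteq> {} \<and>
     \<psi> C1_differentiable_on I \<and>
     tangent \<psi> C1_differentiable_on I \<and>
     (\<lambda>s. vector_derivative (tangent \<psi>) (at s)) C1_differentiable_on I \<and>
     (\<forall>s\<in>I. norm (tangent \<psi> s) = 1) \<and>
     (\<forall>s\<in>I. curvature \<psi> s > 0)"

text \<open>
  \<open>t = \<phi> s\<close> is a change of arclength from \<open>J\<close> onto \<open>I\<close> with \<open>dt/ds = \<Lambda>\<close>, that is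
  \<open>t = \<integral> \<Lambda> ds\<close> for some choice of the constant of integration. It preserves the
  orientation: \<open>\<Lambda>\<close> has no zeros (its reciprocal belongs to the inverse change of arclength),
  and an orientation-reversing change with equal tangents would reverse the principal normal.
\<close>

definition variable_transformation ::
  "(real \<Rightarrow> real) \<Rightarrow> (real \<Rightarrow> real) \<Rightarrow> real set \<Rightarrow> real set \<Rightarrow> bool" where
  "variable_transformation \<phi> \<Lambda> J I \<longleftrightarrow>
     bij_betw \<phi> J I \<and>
     (\<forall>s\<in>J. (\<phi> has_real_derivative \<Lambda> s) (at s) \<and> \<Lambda> s > 0)"

definition similar_curves ::
  "(real \<Rightarrow> real^3) \<Rightarrow> real set \<Rightarrow> (real \<Rightarrow> real^3) \<Rightarrow> real set \<Rightarrow> (real \<Rightarrow> real) \<Rightarrow> bool" where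
  "similar_curves \<alpha> I \<beta> J \<Lambda> \<longleftrightarrow>
     (\<exists>\<phi>. variable_transformation \<phi> \<Lambda> J I \<and> (\<forall>s\<in>J. tangent \<beta> s = tangent \<alpha> (\<phi> s)))"

text \<open>
  Two non-planar general helices (constant ratio of torsion to curvature) with opposite ratios.
  Such curves are never similar, since similar curves have equal ratios at corresponding
  points; but their principal normals may agree under the change of arclength with derivative
  the ratio of the curvatures. An example is
  \<open>(r cos s, r sin s, h s)\<close> and its mirror image \<open>(r cos s, r sin s, - h s)\<close>, where
  \<open>r\<^sup>2 + h\<^sup>2 = 1\<close>, \<open>r > 0\<close> and \<open>h \<noteq> 0\<close>. Integrating \<open>T' = \<kappa> N\<close> determines the tangents only
  up to a constant vector, and these pairs are the only ones for which that constant
  can be nonzero.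
\<close>

definition opposite_general_helices ::
  "(real \<Rightarrow> real^3) \<Rightarrow> real set \<Rightarrow> (real \<Rightarrow> real^3) \<Rightarrow> real set \<Rightarrow> bool" where
  "opposite_general_helices \<alpha> I \<beta> J \<longleftrightarrow>
     (\<exists>c. c \<noteq> 0 \<and> (\<forall>s\<in>I. torsion \<alpha> s / curvature \<alpha> s = c) \<and>
          (\<forall>s\<in>J. torsion \<beta> s / curvature \<beta> s = - c))"

end

theory Submission
  imports Defs
begin

text \<open>
  If \<open>T\<^sub>\<beta> = T\<^sub>\<alpha> \<circ> \<phi>\<close>, the chain rule gives \<open>\<kappa>\<^sub>\<beta> N\<^sub>\<beta> = \<phi>' \<kappa>\<^sub>\<alpha> N\<^sub>\<alpha>\<close> at corresponding
  points. Since \<open>\<phi>' > 0\<close>, comparing norms and then directions yields \<open>\<phi>' = \<kappa>\<^sub>\<beta> / \<kappa>\<^sub>\<alpha>\<close> and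
  \<open>N\<^sub>\<beta> = N\<^sub>\<alpha>\<close> (\<open>curvature_and_normal_of_same_tangents\<close>); the inverse change of arclength
  then has the required derivative \<open>\<kappa>\<^sub>\<alpha> / \<kappa>\<^sub>\<beta>\<close>.

  Conversely, let the normals agree under a change of arclength \<open>\<theta>\<close> with
  \<open>\<theta>' = \<kappa>\<^sub>\<alpha> / \<kappa>\<^sub>\<beta>\<close>. Then \<open>T\<^sub>\<beta> \<circ> \<theta>\<close> and \<open>T\<^sub>\<alpha>\<close> have the same derivative
  \<open>\<kappa>\<^sub>\<alpha> N\<^sub>\<alpha>\<close>, so they differ by a constant vector \<open>C\<close> (\<open>tangents_differ_by_constant\<close>).
  The curves are similar as soon as \<open>C = 0\<close>. Suppose \<open>C \<noteq> 0\<close>. Both tangents are unit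
  vectors, so \<open>C\<close> has a constant nonzero component \<open>a = - \<bar>C\<bar>\<^sup>2 / 2\<close> along \<open>T\<^sub>\<alpha>\<close> and the
  component \<open>a + \<bar>C\<bar>\<^sup>2 = - a\<close> along \<open>T\<^sub>\<beta>\<close>. Both tangents are orthogonal to the common
  normal, so \<open>C\<close> is too, and it is the axis of two general helices. By the Frenet equations its
  component \<open>b\<close> along the binormal is constant with \<open>\<tau> b = \<kappa> (C \<bullet> T)\<close>
  (\<open>constant_vector_orthogonal_to_normals\<close>), and it is the same for both curves, because
  \<open>B\<^sub>\<beta> = (T\<^sub>\<alpha> + C) \<times> N\<^sub>\<alpha>\<close> differs from \<open>B\<^sub>\<alpha>\<close> by a vector orthogonal to \<open>C\<close>.
  The ratios of torsion to curvature are therefore the opposite constants \<open>a / b\<close> and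
  \<open>- a / b\<close>, which is the excluded case (\<open>opposite_helices_if_tangents_differ\<close>).
\<close>

section \<open>Orthonormal frames in space\<close>

unbundle cross3_syntax

lemma norm_cross_orthonormal:
  fixes T N :: "real^3"
  assumes "norm T = 1" "norm N = 1" "T \<bullet> N = 0"
  shows "norm (T \<times> N) = 1"
  using norm_cross_dot[of T N] assms by (simp add: abs_square_eq_1)

text \<open>
  The difference \<open>r\<close> of the two sides is orthogonal to all three frame vectors. Lagrange's
  formula for \<open>r \<times> (T \<times> N)\<close> shows that \<open>r\<close> is also parallel to \<open>T \<times> N\<close>, so \<open>r = 0\<close>.
\<close>

lemma orthonormal_frame_expansion:
  fixes T N v :: "real^3"
  assumes "norm T = 1" "norm N = 1" "T \<bullet> N = 0"
  shows "v = (v \<bullet> T) *\<^sub>R T + (v \<bullet> N) *\<^sub>R N + (v \<bullet> (T \<times> N)) *\<^sub>R (T \<times> N)"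
proof -
  define B where "B = T \<times> N"
  have TT: "T \<bullet> T = 1" "N \<bullet> N = 1" "N \<bullet> T = 0"
    using assms by (simp_all add: norm_eq_1 inner_commute)
  have B: "B \<bullet> T = 0" "B \<bullet> N = 0" "T \<bullet> B = 0" "N \<bullet> B = 0"
    by (simp_all add: B_def dot_cross_self)
  have BB: "B \<bullet> B = 1"
    using norm_cross_orthonormal[OF assms] by (simp add: B_def norm_eq_1)
  define r where "r = v - ((v \<bullet> T) *\<^sub>R T + (v \<bullet> N) *\<^sub>R N + (v \<bullet> B) *\<^sub>R B)"
  have r: "r \<bullet> T = 0" "r \<bullet> N = 0" "r \<bullet> B = 0"
    by (simp_all add: r_def inner_diff_left inner_add_left TT B BB assms(3))
  have "r \<times> B = 0"
    unfolding B_def by (simp add: Lagrange r)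
  then have "r = 0"
    using norm_and_cross_eq_0[of r B] r(3) BB by auto
  then show ?thesis
    by (simp add: r_def B_def)
qed

lemma has_vector_derivative_cross3:
  assumes "(f has_vector_derivative f') (at s)" "(g has_vector_derivative g') (at s)"
  shows "((\<lambda>x. f x \<times> g x) has_vector_derivative (f s \<times> g' + f' \<times> g s)) (at s)"
  using bounded_bilinear.has_vector_derivative[OF _ assms, of "(\<times>)"] bilinear_cross
  by (simp add: bilinear_conv_bounded_bilinear)

text \<open>
  This form turns each orthonormality relation of the Frenet frame into a relation between the
  frame and its derivative.
\<close>

lemma inner_derivative_of_constant_inner:
  fixes f g :: "real \<Rightarrow> 'a::real_inner"
  assumes "open S" "s \<in> S" "\<And>x. x \<in> S \<Longrightarrow> f x \<bullet> g x = c"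
    and "(f has_vector_derivative f') (at s)" "(g has_vector_derivative g') (at s)"
  shows "f s \<bullet> g' + f' \<bullet> g s = 0"
proof -
  have "((\<lambda>x. f x \<bullet> g x) has_vector_derivative (f s \<bullet> g' + f' \<bullet> g s)) (at s)"
    by (rule bounded_bilinear.has_vector_derivative[OF bounded_bilinear_inner assms(4,5)])
  moreover have "((\<lambda>x. f x \<bullet> g x) has_vector_derivative 0) (at s)"
    by (rule has_vector_derivative_transform_within_open[OF has_vector_derivative_const[of c]])
      (use assms in auto)
  ultimately show ?thesis
    by (rule vector_derivative_unique_at)
qed

section \<open>The Frenet equations\<close>

lemma
  assumes "arclength_frenet_curve \<psi> I" "s \<in> I"
  shows norm_tangent: "norm (tangent \<psi> s) = 1"
    and curvature_pos: "curvature \<psi> s > 0"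
    and norm_principal_normal: "norm (principal_normal \<psi> s) = 1"
  using assms by (auto simp: arclength_frenet_curve_def principal_normal_def curvature_def)

lemma has_vector_derivative_tangent:
  assumes "arclength_frenet_curve \<psi> I" "s \<in> I"
  shows "(tangent \<psi> has_vector_derivative curvature \<psi> s *\<^sub>R principal_normal \<psi> s) (at s)"
proof -
  have "tangent \<psi> differentiable at s"
    using assms by (auto simp: arclength_frenet_curve_def C1_differentiable_on_eq)
  then show ?thesis
    using curvature_pos[OF assms] by (simp add: vector_derivative_works principal_normal_def)
qed

lemma tangent_orthogonal_principal_normal:
  assumes "arclength_frenet_curve \<psi> I" "s \<in> I"
  shows "tangent \<psi> s \<bullet> principal_normal \<psi> s = 0"
proof -
  have "open I" using assms by (simp add: arclength_frenet_curve_def)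
  then have "tangent \<psi> s \<bullet> (curvature \<psi> s *\<^sub>R principal_normal \<psi> s)
      + (curvature \<psi> s *\<^sub>R principal_normal \<psi> s) \<bullet> tangent \<psi> s = 0"
    using assms(2) norm_tangent[OF assms(1)] has_vector_derivative_tangent[OF assms]
    by (intro inner_derivative_of_constant_inner[where S = I and c = 1]) (auto simp: norm_eq_1)
  then show ?thesis
    using curvature_pos[OF assms] by (simp add: inner_commute)
qed

lemma principal_normal_differentiable:
  assumes "arclength_frenet_curve \<psi> I" "s \<in> I"
  shows "principal_normal \<psi> differentiable at s"
proof -
  define A where "A = (\<lambda>s. vector_derivative (tangent \<psi>) (at s))"
  have A: "A differentiable at s"
    using assms by (auto simp: arclength_frenet_curve_def C1_differentiable_on_eq A_def)
  have "A s \<noteq> 0"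
    using curvature_pos[OF assms] by (auto simp: curvature_def A_def)
  then have "(\<lambda>x. norm (A x)) differentiable at s"
    using differentiable_compose[OF differentiable_norm_at A] by simp
  then have "(\<lambda>x. inverse (norm (A x)) *\<^sub>R A x) differentiable at s"
    using A \<open>A s \<noteq> 0\<close> by (intro differentiable_scaleR differentiable_inverse) auto
  then show ?thesis
    by (simp add: principal_normal_def[abs_def] curvature_def A_def)
qed

text \<open>
  Differentiating \<open>T \<bullet> N = 0\<close> and \<open>N \<bullet> N = 1\<close> gives the components of \<open>N'\<close> along \<open>T\<close>
  and \<open>N\<close>. The component along \<open>B\<close> is the torsion, because \<open>B' = T \<times> N'\<close>
  (the other term of the product rule is \<open>\<kappa> N \<times> N = 0\<close>) and the triple product
  \<open>- (T \<times> N') \<bullet> N\<close> equals \<open>N' \<bullet> (T \<times> N)\<close>. Substituting \<open>N'\<close> back into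
  \<open>T \<times> N'\<close> gives the equation for \<open>B'\<close>.
\<close>

lemma frenet_equations:
  assumes "arclength_frenet_curve \<psi> I" "s \<in> I"
  shows "(principal_normal \<psi> has_vector_derivative
           - curvature \<psi> s *\<^sub>R tangent \<psi> s + torsion \<psi> s *\<^sub>R binormal \<psi> s) (at s)"
    and "(binormal \<psi> has_vector_derivative - torsion \<psi> s *\<^sub>R principal_normal \<psi> s) (at s)"
proof -
  let ?T = "tangent \<psi>" and ?N = "principal_normal \<psi>" and ?B = "binormal \<psi>"
  define N' where "N' = vector_derivative ?N (at s)"
  have I: "open I" using assms by (simp add: arclength_frenet_curve_def)
  have N': "(?N has_vector_derivative N') (at s)"
    using principal_normal_differentiable[OF assms] by (simp add: N'_def vector_derivative_works)
  note T' = has_vector_derivative_tangent[OF assms]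
  have NN: "?N s \<bullet> ?N s = 1"
    using norm_principal_normal[OF assms] by (simp add: norm_eq_1)
  have "?T s \<bullet> N' + (curvature \<psi> s *\<^sub>R ?N s) \<bullet> ?N s = 0"
    using tangent_orthogonal_principal_normal[OF assms(1)]
    by (intro inner_derivative_of_constant_inner[OF I assms(2) _ T' N'])
  then have N'T: "N' \<bullet> ?T s = - curvature \<psi> s"
    by (simp add: NN inner_commute)
  have "?N s \<bullet> N' + N' \<bullet> ?N s = 0"
    using norm_principal_normal[OF assms(1)]
    by (intro inner_derivative_of_constant_inner[OF I assms(2) _ N' N', of 1]) (auto simp: norm_eq_1)
  then have N'N: "N' \<bullet> ?N s = 0"
    by (simp add: inner_commute)
  have B': "(?B has_vector_derivative ?T s \<times> N') (at s)"
    using has_vector_derivative_cross3[OF T' N']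
    by (simp add: binormal_def[abs_def] cross_mult_left)
  have N'B: "N' \<bullet> ?B s = torsion \<psi> s"
    unfolding torsion_def vector_derivative_at[OF B'] binormal_def
    by (simp add: cross3_simps)
  have N'_eq: "N' = - curvature \<psi> s *\<^sub>R ?T s + torsion \<psi> s *\<^sub>R ?B s"
    using orthonormal_frame_expansion[OF norm_tangent[OF assms] norm_principal_normal[OF assms]
        tangent_orthogonal_principal_normal[OF assms], of N'] N'T N'N N'B
    by (simp add: binormal_def)
  have "?T s \<bullet> ?T s = 1"
    using norm_tangent[OF assms] by (simp add: norm_eq_1)
  then have "?T s \<times> ?B s = - ?N s"
    unfolding binormal_def Lagrange
    by (simp add: tangent_orthogonal_principal_normal[OF assms])
  then have "?T s \<times> N' = - torsion \<psi> s *\<^sub>R ?N s"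
    unfolding N'_eq cross_add_right cross_mult_right by simp
  with B' show "(?B has_vector_derivative - torsion \<psi> s *\<^sub>R ?N s) (at s)"
    by simp
  show "(?N has_vector_derivative - curvature \<psi> s *\<^sub>R ?T s + torsion \<psi> s *\<^sub>R ?B s) (at s)"
    using N' N'_eq by simp
qed

text \<open>
  A nonzero \<open>C\<close> of this kind is the axis of a general helix. Differentiating \<open>C \<bullet> N = 0\<close> gives
  the first relation, and \<open>(C \<bullet> B)' = - \<tau> (C \<bullet> N) = 0\<close> gives the second.
\<close>

lemma constant_vector_orthogonal_to_normals:
  assumes \<psi>: "arclength_frenet_curve \<psi> I" and C: "\<And>s. s \<in> I \<Longrightarrow> C \<bullet> principal_normal \<psi> s = 0"
  shows "s \<in> I \<Longrightarrow> torsion \<psi> s * (C \<bullet> binormal \<psi> s) = curvature \<psi> s * (C \<bullet> tangent \<psi> s)"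
    and "\<exists>b. \<forall>s\<in>I. C \<bullet> binormal \<psi> s = b"
proof -
  have I: "open I" "convex I"
    using \<psi> by (auto simp: arclength_frenet_curve_def is_interval_convex)
  show "torsion \<psi> s * (C \<bullet> binormal \<psi> s) = curvature \<psi> s * (C \<bullet> tangent \<psi> s)" if "s \<in> I"
    using inner_derivative_of_constant_inner[OF I(1) that, of "\<lambda>_. C" "principal_normal \<psi>",
        OF C has_vector_derivative_const frenet_equations(1)[OF \<psi> that]]
    by (simp add: inner_diff_right)
  have "((\<lambda>x. C \<bullet> binormal \<psi> x) has_vector_derivative 0) (at x within I)" if "x \<in> I" for x
    using bounded_bilinear.has_vector_derivative[OF bounded_bilinear_inner
        has_vector_derivative_const[of C] frenet_equations(2)[OF \<psi> that]] C[OF that]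
    by (simp add: has_vector_derivative_at_within)
  then show "\<exists>b. \<forall>s\<in>I. C \<bullet> binormal \<psi> s = b"
    using has_vector_derivative_zero_constant[OF I(2)] by metis
qed

section \<open>Changes of arclength\<close>

lemma variable_transformation_inverse:
  assumes \<phi>: "variable_transformation \<phi> \<Lambda> J I" and "open J"
  shows "variable_transformation (inv_into J \<phi>) (\<lambda>t. inverse (\<Lambda> (inv_into J \<phi> t))) I J"
  unfolding variable_transformation_def
proof (intro conjI ballI)
  have bij: "bij_betw \<phi> J I"
    and der: "\<And>s. s \<in> J \<Longrightarrow> (\<phi> has_real_derivative \<Lambda> s) (at s)"
    and pos: "\<And>s. s \<in> J \<Longrightarrow> \<Lambda> s > 0"
    using \<phi> by (auto simp: variable_transformation_def)
  show bij': "bij_betw (inv_into J \<phi>) I J"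
    using bij by (rule bij_betw_inv_into)
  fix t assume t: "t \<in> I"
  define s where "s = inv_into J \<phi> t"
  have s: "s \<in> J" "\<phi> s = t"
    using bij bij' t by (auto simp: s_def bij_betw_apply bij_betw_inv_into_right)
  have "continuous_on J \<phi>"
    using der by (meson DERIV_continuous_on has_field_derivative_at_within)
  \<comment> \<open>Multiplication by the reciprocal inverts the derivative as a linear map.\<close>
  moreover have "(*) (\<Lambda> s) \<circ> (*) (inverse (\<Lambda> s)) = id"
    using pos[OF s(1)] by (auto simp: fun_eq_iff)
  ultimately have "(inv_into J \<phi> has_derivative (*) (inverse (\<Lambda> s))) (at (\<phi> s))"
    using bij der[OF s(1)] s \<open>open J\<close>
    by (intro has_derivative_inverse_strong[of J s \<phi> _ "(*) (\<Lambda> s)"])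
      (auto simp: bij_betw_inv_into_left has_field_derivative_def)
  then show "(inv_into J \<phi> has_real_derivative inverse (\<Lambda> (inv_into J \<phi> t))) (at t)"
    using s by (simp add: has_field_derivative_def s_def)
  show "inverse (\<Lambda> (inv_into J \<phi> t)) > 0"
    using pos s by (simp add: s_def)
qed

section \<open>Similar curves and principal normals\<close>

text \<open>
  Positivity of \<open>\<Lambda>\<close> is essential: the norms only determine \<open>\<bar>\<Lambda>\<bar>\<close>, and a negative \<open>\<Lambda>\<close>
  would make the normals opposite.
\<close>

lemma curvature_and_normal_of_same_tangents:
  assumes \<alpha>: "arclength_frenet_curve \<alpha> I" and \<beta>: "arclength_frenet_curve \<beta> J"
    and \<phi>: "variable_transformation \<phi> \<Lambda> J I"
    and T: "\<And>s. s \<in> J \<Longrightarrow> tangent \<beta> s = tangent \<alpha> (\<phi> s)" and s: "s \<in> J"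
  shows "curvature \<beta> s = \<Lambda> s * curvature \<alpha> (\<phi> s)"
    and "principal_normal \<beta> s = principal_normal \<alpha> (\<phi> s)"
proof -
  have I: "\<phi> s \<in> I" and der: "(\<phi> has_vector_derivative \<Lambda> s) (at s)" and pos: "\<Lambda> s > 0"
    using \<phi> s
    by (auto simp: variable_transformation_def bij_betw_apply has_real_derivative_iff_has_vector_derivative)
  have "open J" using \<beta> by (simp add: arclength_frenet_curve_def)
  note chain = vector_diff_chain_at[OF der has_vector_derivative_tangent[OF \<alpha> I]]
  have "(tangent \<beta> has_vector_derivative
      \<Lambda> s *\<^sub>R (curvature \<alpha> (\<phi> s) *\<^sub>R principal_normal \<alpha> (\<phi> s))) (at s)"
    by (rule has_vector_derivative_transform_within_open[OF chain \<open>open J\<close> s]) (simp add: T)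
  from vector_derivative_unique_at[OF has_vector_derivative_tangent[OF \<beta> s] this]
  have eq: "curvature \<beta> s *\<^sub>R principal_normal \<beta> s
      = (\<Lambda> s * curvature \<alpha> (\<phi> s)) *\<^sub>R principal_normal \<alpha> (\<phi> s)"
    by simp
  from arg_cong[OF this, of norm]
  show \<kappa>: "curvature \<beta> s = \<Lambda> s * curvature \<alpha> (\<phi> s)"
    using pos curvature_pos[OF \<alpha> I] curvature_pos[OF \<beta> s]
    by (simp add: norm_principal_normal[OF \<alpha> I] norm_principal_normal[OF \<beta> s] abs_mult)
  show "principal_normal \<beta> s = principal_normal \<alpha> (\<phi> s)"
    using eq[folded \<kappa>] curvature_pos[OF \<beta> s] by (metis less_irrefl scaleR_left_imp_eq)
qed

text \<open>
  The prescribed \<open>\<theta>'\<close> cancels \<open>\<kappa>\<^sub>\<beta>\<close> in \<open>(T\<^sub>\<beta> \<circ> \<theta>)' = \<theta>' \<kappa>\<^sub>\<beta> N\<^sub>\<beta>\<close>, which leaves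
  \<open>\<kappa>\<^sub>\<alpha> N\<^sub>\<alpha> = T\<^sub>\<alpha>'\<close>. One constant serves all of \<open>I\<close> because \<open>I\<close> is an interval.
\<close>

lemma tangents_differ_by_constant:
  assumes \<alpha>: "arclength_frenet_curve \<alpha> I" and \<beta>: "arclength_frenet_curve \<beta> J"
    and \<theta>: "variable_transformation \<theta> (\<lambda>s. curvature \<alpha> s / curvature \<beta> (\<theta> s)) I J"
    and N: "\<And>s. s \<in> I \<Longrightarrow> principal_normal \<beta> (\<theta> s) = principal_normal \<alpha> s"
  shows "\<exists>C. \<forall>s\<in>I. tangent \<beta> (\<theta> s) = tangent \<alpha> s + C"
proof -
  have "convex I"
    using \<alpha> by (simp add: arclength_frenet_curve_def is_interval_convex)
  moreover have "((\<lambda>s. tangent \<beta> (\<theta> s) - tangent \<alpha> s) has_vector_derivative 0) (at s within I)"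
    if s: "s \<in> I" for s
  proof -
    have J: "\<theta> s \<in> J"
      and der: "(\<theta> has_vector_derivative curvature \<alpha> s / curvature \<beta> (\<theta> s)) (at s)"
      using \<theta> s
      by (auto simp: variable_transformation_def bij_betw_apply has_real_derivative_iff_has_vector_derivative)
    have "(tangent \<beta> \<circ> \<theta> has_vector_derivative curvature \<alpha> s *\<^sub>R principal_normal \<alpha> s) (at s)"
      using vector_diff_chain_at[OF der has_vector_derivative_tangent[OF \<beta> J]]
        curvature_pos[OF \<beta> J] N[OF s] by simp
    from has_vector_derivative_diff[OF this has_vector_derivative_tangent[OF \<alpha> s]]
    show ?thesis
      by (simp add: has_vector_derivative_at_within o_def)
  qed
  ultimately have "\<exists>C. \<forall>s\<in>I. tangent \<beta> (\<theta> s) - tangent \<alpha> s = C"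
    by (rule has_vector_derivative_zero_constant) auto
  then show ?thesis
    by (simp add: diff_eq_eq add.commute)
qed

text \<open>
  The constant \<open>C\<close> is a common axis of both curves: its components along the two binormals
  agree, whereas those along the two tangents are opposite and nonzero.
\<close>

lemma opposite_helices_if_tangents_differ:
  assumes \<alpha>: "arclength_frenet_curve \<alpha> I" and \<beta>: "arclength_frenet_curve \<beta> J"
    and \<theta>: "\<theta> ` I = J"
    and T: "\<And>s. s \<in> I \<Longrightarrow> tangent \<beta> (\<theta> s) = tangent \<alpha> s + C"
    and N: "\<And>s. s \<in> I \<Longrightarrow> principal_normal \<beta> (\<theta> s) = principal_normal \<alpha> s"
    and "C \<noteq> 0"
  shows "opposite_general_helices \<alpha> I \<beta> J"
proof -
  define a where "a = - (C \<bullet> C) / 2"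
  have "a \<noteq> 0"
    using \<open>C \<noteq> 0\<close> by (simp add: a_def)
  have J: "\<theta> s \<in> J" if "s \<in> I" for s
    using \<theta> that by blast
  have T\<alpha>: "C \<bullet> tangent \<alpha> s = a" if "s \<in> I" for s
  proof -
    have "(tangent \<alpha> s + C) \<bullet> (tangent \<alpha> s + C) = 1"
      using norm_tangent[OF \<beta> J[OF that]] by (simp add: T that norm_eq_1)
    moreover have "tangent \<alpha> s \<bullet> tangent \<alpha> s = 1"
      using norm_tangent[OF \<alpha> that] by (simp add: norm_eq_1)
    ultimately show ?thesis
      by (simp add: a_def inner_add_left inner_add_right inner_commute)
  qed
  have N\<alpha>: "C \<bullet> principal_normal \<alpha> s = 0" if "s \<in> I" for s
    using tangent_orthogonal_principal_normal[OF \<alpha> that]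
      tangent_orthogonal_principal_normal[OF \<beta> J[OF that]]
    by (simp add: T N that inner_add_left)
  obtain b where b: "\<And>s. s \<in> I \<Longrightarrow> C \<bullet> binormal \<alpha> s = b"
    using constant_vector_orthogonal_to_normals(2)[OF \<alpha> N\<alpha>] by blast
  have \<alpha>_ratio: "torsion \<alpha> s * b = curvature \<alpha> s * a" if "s \<in> I" for s
    using constant_vector_orthogonal_to_normals(1)[OF \<alpha> N\<alpha> that] by (simp add: T\<alpha> b that)
  have T\<beta>: "C \<bullet> tangent \<beta> (\<theta> s) = - a" if "s \<in> I" for s
    using T\<alpha>[OF that] by (simp add: T that inner_add_right a_def)
  \<comment> \<open>The extra summand \<open>C \<times> N\<close> of the binormal is orthogonal to \<open>C\<close>.\<close>
  have B\<beta>: "C \<bullet> binormal \<beta> (\<theta> s) = b" if "s \<in> I" for s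
    using b[OF that]
    by (simp add: binormal_def T N that cross_add_left inner_add_right dot_cross_self)
  have N\<beta>: "C \<bullet> principal_normal \<beta> t = 0" if "t \<in> J" for t
    using N\<alpha> N that unfolding \<theta>[symmetric] by auto
  have \<beta>_ratio: "torsion \<beta> t * (C \<bullet> binormal \<beta> t) = curvature \<beta> t * (C \<bullet> tangent \<beta> t)"
    if "t \<in> J" for t
    using constant_vector_orthogonal_to_normals(1)[OF \<beta> N\<beta> that] .
  obtain s where "s \<in> I"
    using \<alpha> by (auto simp: arclength_frenet_curve_def)
  \<comment> \<open>Otherwise \<open>\<kappa> a = 0\<close>, although \<open>\<kappa> > 0\<close> and \<open>a \<noteq> 0\<close>.\<close>
  then have "b \<noteq> 0"
    using \<alpha>_ratio curvature_pos[OF \<alpha>] \<open>a \<noteq> 0\<close> by fastforce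
  have "torsion \<alpha> s / curvature \<alpha> s = a / b" if "s \<in> I" for s
    using \<alpha>_ratio[OF that] curvature_pos[OF \<alpha> that] \<open>b \<noteq> 0\<close> by (simp add: field_simps)
  moreover have "torsion \<beta> t / curvature \<beta> t = - (a / b)" if "t \<in> J" for t
  proof -
    obtain s where s: "s \<in> I" "t = \<theta> s"
      using \<theta> \<open>t \<in> J\<close> by blast
    then have "torsion \<beta> t * b = curvature \<beta> t * (- a)"
      using \<beta>_ratio[OF that] T\<beta> B\<beta> by simp
    then show ?thesis
      using curvature_pos[OF \<beta> that] \<open>b \<noteq> 0\<close> by (simp add: field_simps)
  qed
  ultimately show ?thesis
    unfolding opposite_general_helices_def using \<open>a \<noteq> 0\<close> \<open>b \<noteq> 0\<close>
    by (intro exI[of _ "a / b"]) simp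
qed

theorem theorem4p3:
  fixes \<alpha> \<beta> :: "real \<Rightarrow> real^3" and I J :: "real set"
  assumes "arclength_frenet_curve \<alpha> I"
    and "arclength_frenet_curve \<beta> J"
    and "\<not> opposite_general_helices \<alpha> I \<beta> J"
  shows "(\<exists>\<Lambda>. similar_curves \<alpha> I \<beta> J \<Lambda>) \<longleftrightarrow>
    (\<exists>\<theta>. variable_transformation \<theta> (\<lambda>s. curvature \<alpha> s / curvature \<beta> (\<theta> s)) I J \<and>
         (\<forall>s\<in>I. principal_normal \<beta> (\<theta> s) = principal_normal \<alpha> s))"
proof
  assume "\<exists>\<Lambda>. similar_curves \<alpha> I \<beta> J \<Lambda>"
  then obtain \<Lambda> \<phi> where \<phi>: "variable_transformation \<phi> \<Lambda> J I"
    and T: "\<And>s. s \<in> J \<Longrightarrow> tangent \<beta> s = tangent \<alpha> (\<phi> s)"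
    by (auto simp: similar_curves_def)
  define \<theta> where "\<theta> = inv_into J \<phi>"
  have "open J"
    using assms(2) by (simp add: arclength_frenet_curve_def)
  then have \<theta>: "variable_transformation \<theta> (\<lambda>t. inverse (\<Lambda> (\<theta> t))) I J"
    unfolding \<theta>_def by (rule variable_transformation_inverse[OF \<phi>])
  have \<theta>J: "\<theta> t \<in> J" and \<phi>\<theta>: "\<phi> (\<theta> t) = t" if "t \<in> I" for t
    using \<theta> \<phi> that
    by (auto simp: variable_transformation_def bij_betw_apply \<theta>_def bij_betw_inv_into_right)
  have "inverse (\<Lambda> (\<theta> t)) = curvature \<alpha> t / curvature \<beta> (\<theta> t)" if "t \<in> I" for t
    using curvature_and_normal_of_same_tangents(1)[OF assms(1,2) \<phi> T \<theta>J[OF that]]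
      curvature_pos[OF assms(1) that]
    by (simp add: \<phi>\<theta>[OF that] field_simps)
  with \<theta> have "variable_transformation \<theta> (\<lambda>s. curvature \<alpha> s / curvature \<beta> (\<theta> s)) I J"
    by (simp add: variable_transformation_def)
  moreover have "\<forall>t\<in>I. principal_normal \<beta> (\<theta> t) = principal_normal \<alpha> t"
    using curvature_and_normal_of_same_tangents(2)[OF assms(1,2) \<phi> T \<theta>J] \<phi>\<theta> by simp
  ultimately show "\<exists>\<theta>. variable_transformation \<theta> (\<lambda>s. curvature \<alpha> s / curvature \<beta> (\<theta> s)) I J \<and>
         (\<forall>s\<in>I. principal_normal \<beta> (\<theta> s) = principal_normal \<alpha> s)"
    by blast
next
  assume "\<exists>\<theta>. variable_transformation \<theta> (\<lambda>s. curvature \<alpha> s / curvature \<beta> (\<theta> s)) I J \<and>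
         (\<forall>s\<in>I. principal_normal \<beta> (\<theta> s) = principal_normal \<alpha> s)"
  then obtain \<theta>
    where \<theta>: "variable_transformation \<theta> (\<lambda>s. curvature \<alpha> s / curvature \<beta> (\<theta> s)) I J"
      and N: "\<And>s. s \<in> I \<Longrightarrow> principal_normal \<beta> (\<theta> s) = principal_normal \<alpha> s"
    by blast
  obtain C where C: "\<And>s. s \<in> I \<Longrightarrow> tangent \<beta> (\<theta> s) = tangent \<alpha> s + C"
    using tangents_differ_by_constant[OF assms(1,2) \<theta> N] by blast
  have bij: "bij_betw \<theta> I J"
    using \<theta> by (simp add: variable_transformation_def)
  then have "C = 0"
    using opposite_helices_if_tangents_differ[OF assms(1,2) bij_betw_imp_surj_on C N] assms(3)
    by blast
  define \<phi> where "\<phi> = inv_into I \<theta>"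
  have "open I"
    using assms(1) by (simp add: arclength_frenet_curve_def)
  then have "variable_transformation \<phi>
      (\<lambda>t. inverse (curvature \<alpha> (\<phi> t) / curvature \<beta> (\<theta> (\<phi> t)))) J I"
    unfolding \<phi>_def by (rule variable_transformation_inverse[OF \<theta>])
  moreover have "tangent \<beta> t = tangent \<alpha> (\<phi> t)" if "t \<in> J" for t
  proof -
    have "\<phi> t \<in> I" "\<theta> (\<phi> t) = t"
      using bij that
      by (auto simp: \<phi>_def bij_betw_inv_into_right intro: bij_betw_apply[OF bij_betw_inv_into])
    then show ?thesis
      using C[of "\<phi> t"] \<open>C = 0\<close> by simp
  qed
  ultimately show "\<exists>\<Lambda>. similar_curves \<alpha> I \<beta> J \<Lambda>"
    unfolding similar_curves_def by blast
qed

end
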